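(* For Lebesgue almost all $x\in[0,1]$ and for every $i\in\mathbb N$, the digit $i$ appears only finitely many times in the $\bar O^2$-expansion of $x$, i.e. $\limsup_{n\to\infty}N_i(x,n)<+\infty$.
   Context: $\mathbb N=\{1,2,3,\dots\}$. Every irrational $x\in(0,1)$ has a unique expansion $x=\sum_{n\ge1}\frac{(-1)^{n-1}}{q_n}$ with positive integers $q_n=q_n(x)$ satisfying $q_{n+1}\ge q_n(q_n+1)$ for all $n$ (second Ostrogradsky series). The $\bar O^2$-symbols (digits) of $x$ are $d_1(x)=q_1$ and $d_{k+1}(x)=q_{k+1}-q_k(q_k+1)+1\in\mathbb N$ for $k\ge1$; one writes $x=\bar O^2(d_1(x),d_2(x),\dots)$ and calls this the $\bar O^2$-expansion of $x$. $N_i(x,n)$ is the number of indices $k\in\{1,\dots,n\}$ with $d_k(x)=i$. (Rational numbers form a Lebesgue-null set and have only finite second Ostrogradsky expansions.) *)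

theory Defs
  imports "HOL-Analysis.Analysis"
begin

(* The denominators q_1, q_2, ... are stored as the function q with q n = q_(n+1);
   this turns the sign (-1)^(n-1) into (-1)^n. *)
definition ostro2_expansion :: "real \<Rightarrow> (nat \<Rightarrow> nat) \<Rightarrow> bool" where
  "ostro2_expansion x q \<longleftrightarrow>
     (\<forall>n. q n > 0) \<and> (\<forall>n. q (Suc n) \<ge> q n * (q n + 1)) \<and>
     (\<lambda>n. (-1) ^ n / real (q n)) sums x"

(* Well defined for irrational x in (0,1), by ostro2_expansion_ex1 below. For other x the
   value is unspecified. *)
definition ostro2_seq :: "real \<Rightarrow> nat \<Rightarrow> nat" where
  "ostro2_seq x = (THE q. ostro2_expansion x q)"

(* Denominators and digits are indexed from 1; the values at index 0 are irrelevant. *)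
definition ostro2_denom :: "real \<Rightarrow> nat \<Rightarrow> nat" where
  "ostro2_denom x n = ostro2_seq x (n - 1)"

(* The 1 is added before subtracting, so that the truncated subtraction is exact. *)
definition ostro2_digit :: "real \<Rightarrow> nat \<Rightarrow> nat" where
  "ostro2_digit x k =
     (if k \<le> 1 then ostro2_denom x 1
      else ostro2_denom x k + 1 - ostro2_denom x (k - 1) * (ostro2_denom x (k - 1) + 1))"

definition ostro2_count :: "nat \<Rightarrow> real \<Rightarrow> nat \<Rightarrow> nat" where
  "ostro2_count i x n = card {k \<in> {1..n}. ostro2_digit x k = i}"

lemma ostro2_expansion_pos:
  assumes "ostro2_expansion x q"
  shows "0 < x"
proof -
  define a where "a n = 1 / real (q n)" for n
  have q: "\<And>n. q n > 0" "\<And>n. q n * (q n + 1) \<le> q (Suc n)"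
    and s: "(\<lambda>n. (-1) ^ n * a n) sums x"
    using assms by (auto simp: ostro2_expansion_def a_def)
  have lt: "q n < q (Suc n)" for n
  proof -
    have "q n < q n * (q n + 1)" using q(1)[of n] by simp
    also have "\<dots> \<le> q (Suc n)" by (rule q(2))
    finally show ?thesis .
  qed
  have a_less: "a (Suc n) < a n" for n
    using lt[of n] q(1)[of n] by (simp add: a_def frac_less2)
  have "(\<lambda>n. (-1) ^ n * a n) \<longlonglongrightarrow> 0"
    using s by (intro summable_LIMSEQ_zero) (auto simp: sums_iff)
  hence "(\<lambda>n. \<bar>(-1) ^ n * a n\<bar>) \<longlonglongrightarrow> 0"
    by (rule tendsto_rabs_zero)
  moreover have "\<bar>(-1) ^ n * a n\<bar> = a n" for n
    by (simp add: abs_mult power_abs a_def)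
  ultimately have "a \<longlonglongrightarrow> 0" by simp
  from summable_Leibniz'(2)[OF this, of 1] a_less
  have "(\<Sum>i<2*1. (-1) ^ i * a i) \<le> (\<Sum>i. (-1) ^ i * a i)"
    by (simp add: a_def less_imp_le)
  hence "a 0 - a 1 \<le> x"
    using s by (simp add: sums_iff numeral_2_eq_2)
  with a_less[of 0] show ?thesis by simp
qed

lemma ostro2_expansion_tail:
  assumes "ostro2_expansion x q"
  shows "ostro2_expansion (1 / real (q 0) - x) (\<lambda>n. q (Suc n))"
proof -
  have "(\<lambda>n. (-1) ^ n / real (q n)) sums x"
    using assms by (simp add: ostro2_expansion_def)
  hence "(\<lambda>n. (-1) ^ Suc n / real (q (Suc n))) sums (x - 1 / real (q 0))"
    by (subst sums_Suc_iff) simp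
  from sums_minus[OF this] show ?thesis
    using assms by (simp add: ostro2_expansion_def)
qed

lemma ostro2_expansion_first:
  assumes "ostro2_expansion x q"
  shows "q 0 = nat \<lfloor>1 / x\<rfloor>"
proof -
  have q: "q 0 > 0" "q 0 * (q 0 + 1) \<le> q 1"
    using assms by (auto simp: ostro2_expansion_def)
  have x: "x > 0" using assms by (rule ostro2_expansion_pos)
  have t1: "ostro2_expansion (1 / real (q 0) - x) (\<lambda>n. q (Suc n))"
    by (rule ostro2_expansion_tail[OF assms])
  have up: "x < 1 / real (q 0)"
    using ostro2_expansion_pos[OF t1] by simp
  have "1 / real (q 0) - x < 1 / real (q 1)"
    using ostro2_expansion_pos[OF ostro2_expansion_tail[OF t1]] by simp
  also have "\<dots> \<le> 1 / real (q 0 * (q 0 + 1))"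
    using q by (intro divide_left_mono) (auto simp del: of_nat_mult of_nat_add intro!: mult_pos_pos)
  also have "\<dots> = 1 / real (q 0) - 1 / (real (q 0) + 1)"
    using q by (simp add: field_simps)
  finally have "1 / (real (q 0) + 1) < x" by simp
  hence "1 / x < real (q 0) + 1" using x by (simp add: field_simps)
  moreover have "real (q 0) < 1 / x" using up x q by (simp add: field_simps)
  ultimately have "\<lfloor>1 / x\<rfloor> = int (q 0)" by (intro floor_unique) auto
  thus ?thesis by simp
qed

lemma ostro2_expansion_unique:
  assumes "ostro2_expansion x q" "ostro2_expansion x q'"
  shows "q = q'"
proof
  fix n show "q n = q' n" using assms
  proof (induction n arbitrary: x q q')
    case 0
    thus ?case using ostro2_expansion_first by metis
  next
    case (Suc n)
    have "q 0 = q' 0" using Suc.prems ostro2_expansion_first by metis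
    with Suc.IH[OF ostro2_expansion_tail[OF Suc.prems(1)]] ostro2_expansion_tail[OF Suc.prems(2)]
    show ?case by simp
  qed
qed

lemma ostro2_expansion_exists:
  assumes "x \<notin> \<rat>" "0 < x" "x < 1"
  shows "\<exists>q. ostro2_expansion x q"
proof -
  define r where "r = rec_nat x (\<lambda>_ y. 1 / real (nat \<lfloor>1 / y\<rfloor>) - y)"
  define q where "q n = nat \<lfloor>1 / r n\<rfloor>" for n
  have r0: "r 0 = x" and rS: "r (Suc n) = 1 / real (q n) - r n" for n
    by (simp_all add: r_def q_def)
  have step: "q n > 0 \<and> r n < 1 / real (q n) \<and> 1 / (real (q n) + 1) < r n"
    if "r n \<notin> \<rat>" "0 < r n" "r n < 1" for n
  proof -
    have "1 < 1 / r n" using that by simp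
    hence fl: "\<lfloor>1 / r n\<rfloor> \<ge> 1" by (simp add: le_floor_iff)
    hence qr: "real (q n) = of_int \<lfloor>1 / r n\<rfloor>" and qp: "q n > 0"
      unfolding q_def by linarith+
    have "real (q n) \<noteq> 1 / r n"
    proof
      assume "real (q n) = 1 / r n"
      hence "r n = 1 / real (q n)" by simp
      thus False using that(1) by simp
    qed
    moreover have "real (q n) \<le> 1 / r n" "1 / r n < real (q n) + 1"
      unfolding qr by linarith+
    ultimately have "real (q n) < 1 / r n" "1 / r n < real (q n) + 1" by auto
    thus ?thesis using qp that by (simp add: field_simps)
  qed
  have upper: "r (Suc n) < 1 / real (q n * (q n + 1))" "0 < r (Suc n)"
    if "r n \<notin> \<rat>" "0 < r n" "r n < 1" for n
  proof -
    have "1 / real (q n * (q n + 1)) = 1 / real (q n) - 1 / (real (q n) + 1)"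
      using step[OF that] by (simp add: field_simps)
    thus "r (Suc n) < 1 / real (q n * (q n + 1))" "0 < r (Suc n)"
      using step[OF that] by (auto simp: rS)
  qed
  have r: "r n \<notin> \<rat> \<and> 0 < r n \<and> r n < 1" for n
  proof (induction n)
    case 0
    show ?case using assms by (simp add: r0)
  next
    case (Suc n)
    hence u: "r (Suc n) < 1 / real (q n * (q n + 1))" "0 < r (Suc n)" and qp: "q n > 0"
      using upper step by auto
    have "1 / real (q n * (q n + 1)) \<le> 1"
      using qp by (subst divide_le_eq_1) (auto simp del: of_nat_mult of_nat_add)
    moreover have "r (Suc n) \<notin> \<rat>"
    proof
      assume "r (Suc n) \<in> \<rat>"
      hence "1 / real (q n) - r (Suc n) \<in> \<rat>" by simp
      thus False using Suc by (simp add: rS)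
    qed
    ultimately show ?case using u by auto
  qed
  have qp: "q n > 0" and r_less: "r n < 1 / real (q n)" for n
    using step r by blast+
  have grow: "q n * (q n + 1) \<le> q (Suc n)" for n
  proof -
    have "r (Suc n) < 1 / real (q n * (q n + 1))" using upper r by blast
    moreover have "0 < r (Suc n)" using r by blast
    moreover have "0 < real (q n * (q n + 1))" using qp[of n] by (simp del: of_nat_mult)
    ultimately have "real (q n * (q n + 1)) \<le> 1 / r (Suc n)"
      by (simp only: pos_less_divide_eq pos_le_divide_eq mult.commute less_imp_le)
    hence "int (q n * (q n + 1)) \<le> \<lfloor>1 / r (Suc n)\<rfloor>"
      unfolding le_floor_iff by (simp only: of_int_of_nat_eq)
    thus ?thesis by (simp only: q_def[of "Suc n"] le_nat_iff)
  qed
  have q_ge: "Suc n \<le> q n" for n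
  proof (induction n)
    case 0
    show ?case using qp[of 0] by simp
  next
    case (Suc n)
    have "Suc (q n) \<le> q n * (q n + 1)" using qp[of n] by (simp add: Suc_le_eq)
    with grow[of n] Suc show ?case by linarith
  qed
  have partial: "(\<Sum>k<n. (-1) ^ k / real (q k)) = x - (-1) ^ n * r n" for n
    by (induction n) (simp_all add: r0 rS algebra_simps)
  have "r \<longlonglongrightarrow> 0"
  proof (rule tendsto_sandwich[OF _ _ tendsto_const LIMSEQ_inverse_real_of_nat])
    show "\<forall>\<^sub>F n in sequentially. 0 \<le> r n" using r by (simp add: less_imp_le)
    have "r n \<le> inverse (real (Suc n))" for n
    proof -
      have "r n \<le> 1 / real (q n)" using r_less[of n] by simp
      also have "\<dots> \<le> 1 / real (Suc n)"
        using q_ge[of n] qp[of n] by (intro divide_left_mono mult_pos_pos) linarith+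
      finally show ?thesis by (simp add: inverse_eq_divide)
    qed
    thus "\<forall>\<^sub>F n in sequentially. r n \<le> inverse (real (Suc n))" by simp
  qed
  hence "(\<lambda>n. \<bar>(-1) ^ n * r n\<bar>) \<longlonglongrightarrow> 0"
    by (simp add: abs_mult power_abs tendsto_rabs_zero)
  hence "(\<lambda>n. (-1) ^ n * r n) \<longlonglongrightarrow> 0" by (rule tendsto_rabs_zero_cancel)
  from tendsto_diff[OF tendsto_const[of x] this]
  have "(\<lambda>n. (-1) ^ n / real (q n)) sums x"
    by (simp add: sums_def partial)
  thus ?thesis using qp grow by (auto simp: ostro2_expansion_def)
qed

lemma ostro2_expansion_ex1:
  assumes "x \<notin> \<rat>" "0 < x" "x < 1"
  shows "\<exists>!q. ostro2_expansion x q"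
  using ostro2_expansion_exists[OF assms] ostro2_expansion_unique by blast

lemma ostro2_expansion_seq:
  assumes "x \<notin> \<rat>" "0 < x" "x < 1"
  shows "ostro2_expansion x (ostro2_seq x)"
  unfolding ostro2_seq_def by (rule theI'[OF ostro2_expansion_ex1[OF assms]])

end

theory Submission
  imports Defs
begin

text \<open>
  Let \<open>x \<in> (0, 1)\<close> be irrational. The tail of its expansion from the \<open>n\<close>-th denominator on
  is, up to sign, the expansion of the \<open>n\<close>-th iterate at \<open>x\<close> of the map \<open>G y = 1 / q - y\<close>,
  where \<open>q = \<lfloor>1 / y\<rfloor>\<close> and counting starts from zero. Hence the digit at
  position \<open>k + 2\<close> equals \<open>i\<close> iff the \<open>k\<close>-th iterate of \<open>x\<close> lies in a fixed set \<open>E\<close>, the set of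
  those \<open>y\<close> whose second digit is \<open>i\<close>. By the Borel--Cantelli lemma it suffices that the
  preimages of \<open>E\<close> under the iterates of \<open>G\<close> have summable measures on \<open>[0, 1]\<close>.

  On \<open>(1 / (q + 1), 1 / q]\<close> the map \<open>G\<close> is a reflection, with values in \<open>[0, 1 / (q (q + 1))]\<close>.
  These intervals with \<open>q \<ge> n\<close> fill \<open>(0, 1 / n]\<close>, so the relative measure of \<open>G -` A\<close> in
  \<open>[0, 1 / n]\<close> is an average of relative measures of \<open>A\<close> in intervals \<open>[0, 1 / N]\<close> with
  \<open>N = q (q + 1) \<ge> n + 1\<close>. Since \<open>E\<close> has relative measure at most \<open>1 / n\<^sup>2\<close> in \<open>[0, 1 / n]\<close>, the
  preimage of \<open>E\<close> under the \<open>k\<close>-th iterate has measure at most \<open>1 / (k + 1)\<^sup>2\<close> in \<open>[0, 1]\<close>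
  (\<open>emeasure_preimage_funpow_tail_le\<close>). The true decay is much faster, as \<open>n\<close> is at
  least squared in each step, but this crude bound is already summable.
\<close>

definition first_denom :: "real \<Rightarrow> nat" where
  "first_denom y = nat \<lfloor>1 / y\<rfloor>"

definition ostro2_tail :: "real \<Rightarrow> real" where
  "ostro2_tail y = 1 / real (first_denom y) - y"

definition second_digit_set :: "nat \<Rightarrow> real set" where
  "second_digit_set i =
     {y. first_denom (ostro2_tail y) + 1 = first_denom y * (first_denom y + 1) + i}"

section \<open>Digits in terms of iterated tails\<close>

lemma ostro2_expansion_funpow_tail:
  assumes "ostro2_expansion x q"
  shows "ostro2_expansion ((ostro2_tail ^^ n) x) (\<lambda>m. q (m + n))"
proof (induction n)
  case 0
  show ?case using assms by simp
next
  case (Suc n)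
  from ostro2_expansion_tail[OF this] ostro2_expansion_first[OF this]
  show ?case by (simp add: ostro2_tail_def first_denom_def)
qed

lemma ostro2_seq_eq_first_denom:
  assumes "x \<notin> \<rat>" "0 < x" "x < 1"
  shows "ostro2_seq x n = first_denom ((ostro2_tail ^^ n) x)"
  using ostro2_expansion_first[OF ostro2_expansion_funpow_tail[OF ostro2_expansion_seq[OF assms]]]
  by (simp add: first_denom_def)

lemma ostro2_digit_eq_imp_second_digit_set:
  assumes "x \<notin> \<rat>" "0 < x" "x < 1" and "ostro2_digit x (k + 2) = i"
  shows "(ostro2_tail ^^ k) x \<in> second_digit_set i"
proof -
  have "ostro2_seq x k * (ostro2_seq x k + 1) \<le> ostro2_seq x (Suc k)"
    using ostro2_expansion_seq[OF assms(1-3)] by (simp add: ostro2_expansion_def)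
  moreover have "ostro2_seq x (Suc k) + 1 - ostro2_seq x k * (ostro2_seq x k + 1) = i"
    using assms(4) by (simp add: ostro2_digit_def ostro2_denom_def)
  ultimately have "ostro2_seq x (Suc k) + 1 = ostro2_seq x k * (ostro2_seq x k + 1) + i"
    by linarith
  thus ?thesis
    by (simp add: second_digit_set_def ostro2_seq_eq_first_denom[OF assms(1-3)])
qed

section \<open>Measure estimates\<close>

lemma measurable_first_denom [measurable]: "first_denom \<in> borel \<rightarrow>\<^sub>M count_space UNIV"
  unfolding first_denom_def by measurable

lemma measurable_ostro2_tail [measurable]: "ostro2_tail \<in> borel \<rightarrow>\<^sub>M borel"
  unfolding ostro2_tail_def by measurable

lemma measurable_funpow_tail [measurable]: "(ostro2_tail ^^ k) \<in> borel \<rightarrow>\<^sub>M borel"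
  by (induction k) (auto intro: measurable_comp)

lemma sets_second_digit_set [measurable]: "second_digit_set i \<in> sets borel"
proof -
  have "second_digit_set i = (\<Union>q. first_denom -` {q} \<inter>
          (\<lambda>y. first_denom (ostro2_tail y)) -` {m. m + 1 = q * (q + 1) + i})"
    by (auto simp: second_digit_set_def)
  moreover have "f -` X \<in> sets borel"
    if "f \<in> borel \<rightarrow>\<^sub>M count_space UNIV" for f :: "real \<Rightarrow> nat" and X
    using measurable_sets[OF that, of X] by simp
  moreover have "(\<lambda>y. first_denom (ostro2_tail y)) \<in> borel \<rightarrow>\<^sub>M count_space UNIV"
    by measurable
  ultimately show ?thesis
    using measurable_first_denom by (simp add: sets.countable_UN sets.Int)
qed

lemma first_denom_eq:
  assumes "y \<in> {1 / (real q + 1)<..1 / real q}" "q > 0"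
  shows "first_denom y = q"
proof -
  have "y > 0" using assms by (auto intro: less_trans[rotated])
  hence "real q \<le> 1 / y" "1 / y < real q + 1"
    using assms by (auto simp: field_simps)
  hence "\<lfloor>1 / y\<rfloor> = int q" by (intro floor_unique) auto
  thus ?thesis by (simp add: first_denom_def)
qed

lemma first_denom_bounds:
  assumes "first_denom y = q" "q > 0"
  shows "1 / (real q + 1) < y" "y \<le> 1 / real q"
proof -
  have fl: "\<lfloor>1 / y\<rfloor> = int q" using assms by (auto simp: first_denom_def)
  hence *: "real q \<le> 1 / y" "1 / y < real q + 1" by linarith+
  have "1 / y > 0" using * assms(2) by linarith
  hence "y > 0" by simp
  thus "1 / (real q + 1) < y" "y \<le> 1 / real q"
    using * assms(2) by (auto simp: field_simps)
qed

lemma emeasure_lborel_reflect: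
  assumes [measurable]: "A \<in> sets borel"
  shows "emeasure lborel ((\<lambda>y. c - y) -` A) = emeasure lborel (A :: real set)"
proof -
  have "lborel = distr lborel borel (\<lambda>y. c - y)"
    by (subst lborel_real_affine[of "-1" c]) (simp_all add: density_1)
  hence "emeasure lborel A = emeasure (distr lborel borel (\<lambda>y. c - y)) A" by metis
  also have "\<dots> = emeasure lborel ((\<lambda>y. c - y) -` A)"
    by (subst emeasure_distr) auto
  finally show ?thesis by simp
qed

lemma sums_inverse_pronic:
  assumes "n > 0"
  shows "(\<lambda>j. 1 / (real (n + j) * (real (n + j) + 1))) sums (1 / real n)"
proof -
  have "(\<lambda>j. 1 / real (n + j)) \<longlonglongrightarrow> 0"
    using LIMSEQ_ignore_initial_segment[OF lim_1_over_n, of n] by (simp add: add.commute)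
  from telescope_sums'[OF this]
  have "(\<lambda>j. 1 / real (n + j) - 1 / real (n + Suc j)) sums (1 / real n)" by simp
  moreover have "1 / real (n + j) - 1 / real (n + Suc j) = 1 / (real (n + j) * (real (n + j) + 1))"
    for j using assms by (simp add: field_simps)
  ultimately show ?thesis by simp
qed

lemma Icc_subset_UN_first_denom:
  assumes "n > 0"
  shows "{0..1 / real n} \<subseteq>
           {0} \<union> (\<Union>j. {1 / (real (n + j) + 1)<..1 / real (n + j)})"
proof
  fix y assume y: "y \<in> {0..1 / real n}"
  show "y \<in> {0} \<union> (\<Union>j. {1 / (real (n + j) + 1)<..1 / real (n + j)})"
  proof (cases "y = 0")
    case False
    with y have "y > 0" "real n \<le> 1 / y" using assms by (auto simp: field_simps)
    hence "int n \<le> \<lfloor>1 / y\<rfloor>" by (simp add: le_floor_iff)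
    hence le: "n \<le> first_denom y" by (simp add: first_denom_def)
    then obtain j where "first_denom y = n + j" using le_Suc_ex by blast
    with first_denom_bounds[of y "n + j"] assms show ?thesis by auto
  qed simp
qed

text \<open>The weights \<open>1 / (q * (q + 1))\<close> are the lengths of the pieces, so this passes from a bound
  \<open>c\<close> on the relative measure in each piece to the same bound in the whole interval.\<close>

lemma emeasure_Icc_le_if_pieces_le:
  assumes [measurable]: "B \<in> sets borel" and "n > 0" "c \<ge> 0"
    and piece: "\<And>q. q \<ge> n \<Longrightarrow>
      emeasure lborel (B \<inter> {1 / (real q + 1)<..1 / real q}) \<le> ennreal (c / (real q * (real q + 1)))"
  shows "emeasure lborel (B \<inter> {0..1 / real n}) \<le> ennreal (c / real n)"
proof -
  define P where "P j = B \<inter> {1 / (real (n + j) + 1)<..1 / real (n + j)}" for j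
  have [measurable]: "P j \<in> sets borel" for j unfolding P_def by measurable
  have sums: "(\<lambda>j. c / (real (n + j) * (real (n + j) + 1))) sums (c / real n)"
    using sums_mult[OF sums_inverse_pronic[OF \<open>n > 0\<close>], of c] by simp
  have "emeasure lborel (B \<inter> {0..1 / real n}) \<le> emeasure lborel ({0} \<union> (\<Union>j. P j))"
    using Icc_subset_UN_first_denom[OF \<open>n > 0\<close>] by (intro emeasure_mono) (auto simp: P_def)
  also have "\<dots> \<le> emeasure lborel {0::real} + emeasure lborel (\<Union>j. P j)"
    by (intro emeasure_subadditive) auto
  also have "\<dots> = emeasure lborel (\<Union>j. P j)" by simp
  also have "\<dots> \<le> (\<Sum>j. emeasure lborel (P j))"
    by (intro emeasure_subadditive_countably) auto
  also have "\<dots> \<le> (\<Sum>j. ennreal (c / (real (n + j) * (real (n + j) + 1))))"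
    unfolding P_def by (intro suminf_le piece) auto
  also have "\<dots> = ennreal (c / real n)"
    using sums \<open>c \<ge> 0\<close> by (intro suminf_ennreal_eq) auto
  finally show ?thesis .
qed

text \<open>With the denominator \<open>q\<close> given, digit \<open>i\<close> forces the next denominator to be
  \<open>m = q * (q + 1) + i - 1\<close>, hence the tail to an interval of length \<open>1 / (m * (m + 1))\<close>. This is
  at most \<open>1 / n\<^sup>2\<close> times the length of the piece.\<close>

lemma emeasure_second_digit_set_le:
  assumes "n > 0" "i \<ge> 1"
  shows "emeasure lborel (second_digit_set i \<inter> {0..1 / real n}) \<le> ennreal (1 / (real n)\<^sup>2 / real n)"
proof (rule emeasure_Icc_le_if_pieces_le)
  fix q assume "q \<ge> n"
  hence "q > 0" using assms by simp
  define m where "m = q * (q + 1) + i - 1"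
  have m: "m \<ge> q * (q + 1)" "m > 0" using \<open>q > 0\<close> assms by (auto simp: m_def)
  have "second_digit_set i \<inter> {1 / (real q + 1)<..1 / real q}
          \<subseteq> {1 / real q - 1 / real m..1 / real q - 1 / (real m + 1)}"
  proof
    fix y assume y: "y \<in> second_digit_set i \<inter> {1 / (real q + 1)<..1 / real q}"
    have fd: "first_denom y = q" using y \<open>q > 0\<close> by (intro first_denom_eq) auto
    hence "first_denom (1 / real q - y) = m"
      using y by (auto simp: second_digit_set_def ostro2_tail_def m_def)
    from first_denom_bounds[OF this \<open>m > 0\<close>]
    show "y \<in> {1 / real q - 1 / real m..1 / real q - 1 / (real m + 1)}" by auto
  qed
  hence "emeasure lborel (second_digit_set i \<inter> {1 / (real q + 1)<..1 / real q})
           \<le> emeasure lborel {1 / real q - 1 / real m..1 / real q - 1 / (real m + 1)}"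
    by (intro emeasure_mono) auto
  also have "\<dots> = ennreal (1 / (real m * (real m + 1)))"
    using m by (subst emeasure_lborel_Icc) (auto simp: field_simps)
  also have "\<dots> \<le> ennreal (1 / (real n)\<^sup>2 / (real q * (real q + 1)))"
  proof (rule ennreal_leI)
    have mq: "real q * (real q + 1) \<le> real m"
      using m(1) by (metis of_nat_1 of_nat_add of_nat_le_iff of_nat_mult)
    have "(real n)\<^sup>2 \<le> (real q)\<^sup>2" using \<open>q \<ge> n\<close> by (intro power_mono) auto
    also have "\<dots> \<le> real q * (real q + 1)" by (simp add: power2_eq_square algebra_simps)
    finally have "(real n)\<^sup>2 \<le> real m + 1" using mq by linarith
    hence "(real n)\<^sup>2 * (real q * (real q + 1)) \<le> (real m + 1) * real m"
      using mq by (intro mult_mono) auto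
    moreover have "0 < (real n)\<^sup>2 * (real q * (real q + 1))" using assms \<open>q > 0\<close> by simp
    ultimately have "1 / ((real m + 1) * real m) \<le> 1 / ((real n)\<^sup>2 * (real q * (real q + 1)))"
      by (intro divide_left_mono mult_pos_pos) (use m assms \<open>q > 0\<close> in auto)
    thus "1 / (real m * (real m + 1)) \<le> 1 / (real n)\<^sup>2 / (real q * (real q + 1))"
      by (simp add: mult.commute)
  qed
  finally show "emeasure lborel (second_digit_set i \<inter> {1 / (real q + 1)<..1 / real q})
                  \<le> ennreal (1 / (real n)\<^sup>2 / (real q * (real q + 1)))" .
qed (use assms in auto)

text \<open>Each application of the tail map replaces \<open>n\<close> by some \<open>q * (q + 1) \<ge> n + 1\<close>, so a step of the
  iteration gains at least as much as an increase of \<open>n\<close> by one.\<close>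

lemma emeasure_preimage_funpow_tail_le:
  assumes "i \<ge> 1" "n > 0"
  shows "emeasure lborel ((ostro2_tail ^^ k) -` second_digit_set i \<inter> {0..1 / real n})
           \<le> ennreal (1 / (real (n + k))\<^sup>2 / real n)"
  using \<open>n > 0\<close>
proof (induction k arbitrary: n)
  case 0
  thus ?case using emeasure_second_digit_set_le assms by simp
next
  case (Suc k)
  define A where "A = (ostro2_tail ^^ k) -` second_digit_set i"
  have [measurable]: "(ostro2_tail ^^ k) -` second_digit_set i \<in> sets borel" for k
    using measurable_sets[OF measurable_funpow_tail sets_second_digit_set] by simp
  have [measurable]: "A \<in> sets borel" unfolding A_def by measurable
  have eq: "(ostro2_tail ^^ Suc k) -` second_digit_set i = ostro2_tail -` A"
    by (simp only: A_def funpow_Suc_right vimage_comp)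
  show ?case
  proof (rule emeasure_Icc_le_if_pieces_le)
    fix q assume "q \<ge> n"
    hence "q > 0" using Suc.prems by simp
    define N where "N = q * (q + 1)"
    have N: "N > 0" "real N = real q * (real q + 1)" "Suc n \<le> N"
    proof -
      show "N > 0" "real N = real q * (real q + 1)" using \<open>q > 0\<close> by (auto simp: N_def distrib_left)
      have "q + 1 \<le> q * (q + 1)" using \<open>q > 0\<close> by simp
      thus "Suc n \<le> N" using \<open>q \<ge> n\<close> by (simp only: N_def)
    qed
    have "(ostro2_tail ^^ Suc k) -` second_digit_set i \<inter> {1 / (real q + 1)<..1 / real q}
            \<subseteq> (\<lambda>y. 1 / real q - y) -` (A \<inter> {0..1 / real N})"
    proof
      fix y
      assume y: "y \<in> (ostro2_tail ^^ Suc k) -` second_digit_set i \<inter> {1 / (real q + 1)<..1 / real q}"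
      have "first_denom y = q" using y \<open>q > 0\<close> by (intro first_denom_eq) auto
      hence "1 / real q - y \<in> A" using y unfolding eq by (simp add: ostro2_tail_def)
      moreover have "1 / real N = 1 / real q - 1 / (real q + 1)"
        using \<open>q > 0\<close> by (simp add: N field_simps)
      ultimately show "y \<in> (\<lambda>y. 1 / real q - y) -` (A \<inter> {0..1 / real N})" using y by auto
    qed
    hence "emeasure lborel ((ostro2_tail ^^ Suc k) -` second_digit_set i
             \<inter> {1 / (real q + 1)<..1 / real q})
             \<le> emeasure lborel ((\<lambda>y. 1 / real q - y) -` (A \<inter> {0..1 / real N}))"
      using measurable_sets_borel[of "\<lambda>y. 1 / real q - y" borel "A \<inter> {0..1 / real N}"]
      by (intro emeasure_mono) auto
    also have "\<dots> = emeasure lborel (A \<inter> {0..1 / real N})"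
      by (rule emeasure_lborel_reflect) auto
    also have "\<dots> \<le> ennreal (1 / (real (N + k))\<^sup>2 / real N)"
      unfolding A_def using N(1) by (rule Suc.IH)
    also have "\<dots> \<le> ennreal (1 / (real (n + Suc k))\<^sup>2 / real N)"
    proof (intro ennreal_leI divide_right_mono divide_left_mono power_mono)
      show "real (n + Suc k) \<le> real (N + k)" using N(3) by simp
    qed (use N in auto)
    finally show "emeasure lborel ((ostro2_tail ^^ Suc k) -` second_digit_set i
                    \<inter> {1 / (real q + 1)<..1 / real q})
                    \<le> ennreal (1 / (real (n + Suc k))\<^sup>2 / (real q * (real q + 1)))"
      by (simp only: N(2))
  next
    show "(ostro2_tail ^^ Suc k) -` second_digit_set i \<in> sets borel" by fact
  qed (use Suc.prems in auto)
qed

section \<open>Almost every point\<close>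

lemma AE_eventually_funpow_tail_notin_second_digit_set:
  assumes "i \<ge> 1"
  shows "AE x in lborel. x \<in> {0..1} \<longrightarrow>
           (\<forall>\<^sub>F k in sequentially. (ostro2_tail ^^ k) x \<notin> second_digit_set i)"
proof -
  define S where "S k = (ostro2_tail ^^ k) -` second_digit_set i \<inter> {0..1}" for k
  have sets: "S k \<in> sets lborel" for k
    using measurable_sets[OF measurable_funpow_tail sets_second_digit_set, of k i]
    by (auto simp: S_def)
  have le: "emeasure lborel (S k) \<le> ennreal (1 / (real (Suc k))\<^sup>2)" for k
    using emeasure_preimage_funpow_tail_le[OF assms, of 1 k] by (simp add: S_def)
  have fin: "emeasure lborel (S k) < \<infinity>" for k
    using le[of k] by (rule le_less_trans) simp
  have meas_le: "norm (measure lborel (S k)) \<le> 1 / (real (Suc k))\<^sup>2" for k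
  proof -
    have "measure lborel (S k) \<le> 1 / (real (Suc k))\<^sup>2"
      unfolding measure_def using le[of k] by (intro enn2real_leI) auto
    thus ?thesis by simp
  qed
  have "summable (\<lambda>k. 1 / (real (Suc k))\<^sup>2)"
    using inverse_squares_sums by (simp add: sums_iff add.commute)
  hence "summable (\<lambda>k. measure lborel (S k))"
    using meas_le by (rule summable_comparison_test')
  from borel_cantelli_AE1[OF sets fin this]
  show ?thesis
  proof eventually_elim
    case (elim x)
    show ?case
    proof
      assume "x \<in> {0..1}"
      with elim show "\<forall>\<^sub>F k in sequentially. (ostro2_tail ^^ k) x \<notin> second_digit_set i"
        by (auto simp only: S_def space_lborel vimage_def elim!: eventually_mono)
    qed
  qed
qed

lemma finite_digit_positions:
  assumes "x \<notin> \<rat>" "0 < x" "x < 1"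
    and "\<forall>\<^sub>F k in sequentially. (ostro2_tail ^^ k) x \<notin> second_digit_set i"
  shows "finite {k. k \<ge> 1 \<and> ostro2_digit x k = i}"
proof -
  from assms(4) obtain K where K: "\<And>k. k \<ge> K \<Longrightarrow> (ostro2_tail ^^ k) x \<notin> second_digit_set i"
    by (auto simp: eventually_sequentially)
  have "k < K + 2" if "ostro2_digit x k = i" for k
  proof (rule ccontr)
    assume "\<not> k < K + 2"
    hence "k - 2 \<ge> K" "k - 2 + 2 = k" by auto
    with ostro2_digit_eq_imp_second_digit_set[OF assms(1-3), of "k - 2" i] K that
    show False by auto
  qed
  hence "{k. k \<ge> 1 \<and> ostro2_digit x k = i} \<subseteq> {..<K + 2}" by auto
  thus ?thesis by (rule finite_subset) simp
qed

lemma limsup_ostro2_count_finite: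
  assumes "finite {k. k \<ge> 1 \<and> ostro2_digit x k = i}"
  shows "limsup (\<lambda>n. ereal (real (ostro2_count i x n))) < \<infinity>"
proof -
  let ?D = "{k. k \<ge> 1 \<and> ostro2_digit x k = i}"
  have "ostro2_count i x n \<le> card ?D" for n
    unfolding ostro2_count_def using assms by (intro card_mono) auto
  hence "limsup (\<lambda>n. ereal (real (ostro2_count i x n))) \<le> ereal (real (card ?D))"
    by (intro Limsup_bounded always_eventually) auto
  also have "\<dots> < \<infinity>" by simp
  finally show ?thesis .
qed

theorem theorem1:
  shows "AE x in lebesgue. x \<in> {0..1} \<longrightarrow>
           (\<forall>i::nat. i \<ge> 1 \<longrightarrow>
              finite {k::nat. k \<ge> 1 \<and> ostro2_digit x k = i} \<and>
              limsup (\<lambda>n. ereal (real (ostro2_count i x n))) < \<infinity>)"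
proof (rule AE_completion)
  have "AE x in lborel. \<forall>i. i \<ge> 1 \<longrightarrow> x \<in> {0..1} \<longrightarrow>
          (\<forall>\<^sub>F k in sequentially. (ostro2_tail ^^ k) x \<notin> second_digit_set i)"
    unfolding AE_all_countable
    using AE_eventually_funpow_tail_notin_second_digit_set by auto
  moreover have "AE x in lborel. x \<notin> (\<rat> :: real set)"
    by (intro AE_not_in countable_imp_null_set_lborel countable_rat)
  ultimately show "AE x in lborel. x \<in> {0..1} \<longrightarrow>
           (\<forall>i::nat. i \<ge> 1 \<longrightarrow>
              finite {k::nat. k \<ge> 1 \<and> ostro2_digit x k = i} \<and>
              limsup (\<lambda>n. ereal (real (ostro2_count i x n))) < \<infinity>)"
  proof eventually_elim
    case (elim x)
    show ?case
    proof (intro impI allI)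
      fix i :: nat assume x: "x \<in> {0..1}" and "i \<ge> 1"
      have "x \<noteq> 0" "x \<noteq> 1" using elim(2) by auto
      with x have "0 < x" "x < 1" by auto
      with elim x \<open>i \<ge> 1\<close> have fin: "finite {k. k \<ge> 1 \<and> ostro2_digit x k = i}"
        by (intro finite_digit_positions) auto
      thus "finite {k. k \<ge> 1 \<and> ostro2_digit x k = i} \<and>
              limsup (\<lambda>n. ereal (real (ostro2_count i x n))) < \<infinity>"
        using limsup_ostro2_count_finite by blast
    qed
  qed
qed

end
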